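(* Let $d\ge 2$ be an integer and let $s>0$ be real. Let $\mathbf{u}_0,\ldots,\mathbf{u}_d\in\mathbb{E}^d$ be the vertices of a regular $d$-simplex centered at the origin with $|\mathbf{u}_i|=1$ for all $i$. For $i,j\in\{0,\ldots,d\}$ with $i\ne j$, put $$\mathbf{b}^i_j=\mathbf{u}_j+s\mathbf{u}_i,\qquad \mathbf{c}^i_j=\mathbf{u}_j-s\mathbf{u}_i .$$ Let $\mathbf{p}$ be the configuration of $(d+1)^2$ points consisting of the $\mathbf{u}_i$ $(0\le i\le d)$ together with the $\mathbf{b}^i_j$ $(i\neq j)$, and let $\mathbf{q}$ be the configuration consisting of the $\mathbf{u}_i$ $(0\le i\le d)$ together with the $\mathbf{c}^i_j$ $(i\ne j)$, ordered so that $\mathbf{u}_i$ in $\mathbf{p}$ corresponds to $\mathbf{u}_i$ in $\mathbf{q}$ and $\mathbf{b}^i_j$ corresponds to $\mathbf{c}^i_j$. Then: (a) $\mathbf{q}$ is an expansion of $\mathbf{p}$ in $\mathbb{E}^d$; (b) for every integer $f$ with $d\le f<2d$, there does not exist a continuous expansion from $\mathbf{p}$ to $\mathbf{q}$ in $\mathbb{E}^f$.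
   Context: $\mathbb{E}^n$ denotes $n$-dimensional Euclidean space (points identified with vectors in $\mathbb{R}^n$) with its standard inner product and norm $|\cdot|$. For $f\ge d$, $\iota:\mathbb{E}^d\to\mathbb{E}^f$ is the standard inclusion $\iota(u_1,\ldots,u_d)=(u_1,\ldots,u_d,0,\ldots,0)$ (the identity if $f=d$). The regular simplex centered at the origin with unit-norm vertices satisfies $\mathbf{u}_i\cdot\mathbf{u}_j=-\frac1d$ for $i\neq j$. Configurations are finite ordered families of points (repetitions allowed). Let $\mathbf{p}=(\mathbf{p}_1,\ldots,\mathbf{p}_N)$ and $\mathbf{q}=(\mathbf{q}_1,\ldots,\mathbf{q}_N)$ be configurations of $N$ ordered points in $\mathbb{E}^d$. We say $\mathbf{q}$ is an expansion of $\mathbf{p}$ if $|\mathbf{p}_i-\mathbf{p}_j|\le|\mathbf{q}_i-\mathbf{q}_j|$ for all $1\le i<j\le N$. We say there is a continuous expansion from $\mathbf{p}$ to $\mathbf{q}$ in $\mathbb{E}^f$ if there exist continuous functions $\mathbf{f}_i:[0,1]\to\mathbb{E}^f$, $i=1,\ldots,N$, such that for all $1\le i<j\le N$ and $0\le t_1<t_2\le 1$: (1) for every index $k\in\{1,\ldots,N\}$, $\mathbf{f}_k(0)=\iota(\mathbf{p}_k)$ and $\mathbf{f}_k(1)=\iota(\mathbf{q}_k)$; (2) $|\mathbf{f}_i(t_1)-\mathbf{f}_j(t_1)|\le|\mathbf{f}_i(t_2)-\mathbf{f}_j(t_2)|$. *)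

theory Defs
  imports "HOL-Analysis.Analysis"
begin

text \<open>
  Points of \<open>\<E>\<^sup>n\<close> are elements of the carrier of the library's topological space
  \<^const>\<open>Euclidean_space\<close> \<open>n\<close>: functions \<open>nat \<Rightarrow> real\<close> vanishing at all indices \<open>\<ge> n\<close>.
  Coordinates are thus numbered from 0, and the dimension is a natural number
  that can be quantified over. The type-class metric \<^const>\<open>dist\<close> on functions
  \<open>nat \<Rightarrow> real\<close> is not the Euclidean one; \<open>edist\<close> below is.
\<close>

type_synonym point = "nat \<Rightarrow> real"

abbreviation E :: "nat \<Rightarrow> point set" where
  "E n \<equiv> topspace (Euclidean_space n)"

definition enorm :: "nat \<Rightarrow> point \<Rightarrow> real" where
  "enorm n x = L2_set x {..<n}"

definition edist :: "nat \<Rightarrow> point \<Rightarrow> point \<Rightarrow> real" where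
  "edist n x y = enorm n (\<lambda>k. x k - y k)"

text \<open>
  On the carrier of \<open>\<E>\<^sup>d\<close> the standard inclusion does not change the underlying
  function, since coordinates beyond \<open>d\<close> are already zero there.
\<close>

definition incl :: "nat \<Rightarrow> point \<Rightarrow> point" where
  "incl d x = (\<lambda>k. if k < d then x k else 0)"

lemma incl_eq: "x \<in> E d \<Longrightarrow> incl d x = x"
  by (auto simp: incl_def topspace_Euclidean_space fun_eq_iff)

text \<open>Configurations are lists of points, with indices running from 0.\<close>

definition is_configuration :: "nat \<Rightarrow> nat \<Rightarrow> point list \<Rightarrow> bool" where
  "is_configuration d N p \<longleftrightarrow> length p = N \<and> set p \<subseteq> E d"

definition is_expansion :: "nat \<Rightarrow> point list \<Rightarrow> point list \<Rightarrow> bool" where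
  "is_expansion d p q \<longleftrightarrow>
     length p = length q \<and>
     (\<forall>i j. i < j \<and> j < length p \<longrightarrow> edist d (p ! i) (p ! j) \<le> edist d (q ! i) (q ! j))"

definition continuous_expansion :: "nat \<Rightarrow> nat \<Rightarrow> point list \<Rightarrow> point list \<Rightarrow> bool" where
  "continuous_expansion d f p q \<longleftrightarrow>
     length p = length q \<and>
     (\<exists>F :: nat \<Rightarrow> real \<Rightarrow> point.
        (\<forall>k < length p.
           continuous_map (top_of_set {0..1}) (Euclidean_space f) (F k) \<and>
           F k 0 = incl d (p ! k) \<and> F k 1 = incl d (q ! k)) \<and>
        (\<forall>i j t1 t2. i < j \<and> j < length p \<and> 0 \<le> t1 \<and> t1 < t2 \<and> t2 \<le> 1 \<longrightarrow>
           edist f (F i t1) (F j t1) \<le> edist f (F i t2) (F j t2)))"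

text \<open>
  A simplex has affinely independent vertices. The library's \<^const>\<open>affine_dependent\<close>
  needs a vector space type, which \<^typ>\<open>nat \<Rightarrow> real\<close> is not, so affine
  independence of a family is written out.
\<close>

definition simplex_vertices :: "nat \<Rightarrow> (nat \<Rightarrow> point) \<Rightarrow> bool" where
  "simplex_vertices d u \<longleftrightarrow>
     (\<forall>i\<le>d. u i \<in> E d) \<and>
     (\<forall>c. (\<Sum>i\<le>d. c i) = 0 \<and> (\<forall>k<d. (\<Sum>i\<le>d. c i * u i k) = 0) \<longrightarrow> (\<forall>i\<le>d. c i = 0))"

definition regular_simplex_vertices :: "nat \<Rightarrow> (nat \<Rightarrow> point) \<Rightarrow> bool" where
  "regular_simplex_vertices d u \<longleftrightarrow>
     simplex_vertices d u \<and>
     (\<exists>a. \<forall>i\<le>d. \<forall>j\<le>d. i \<noteq> j \<longrightarrow> edist d (u i) (u j) = a)"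

definition centroid :: "nat \<Rightarrow> (nat \<Rightarrow> point) \<Rightarrow> point" where
  "centroid d u = (\<lambda>k. (\<Sum>i\<le>d. u i k) / real (d + 1))"

definition b_point :: "real \<Rightarrow> (nat \<Rightarrow> point) \<Rightarrow> nat \<Rightarrow> nat \<Rightarrow> point" where
  "b_point s u i j = (\<lambda>k. u j k + s * u i k)"

definition c_point :: "real \<Rightarrow> (nat \<Rightarrow> point) \<Rightarrow> nat \<Rightarrow> nat \<Rightarrow> point" where
  "c_point s u i j = (\<lambda>k. u j k - s * u i k)"

definition off_diagonal :: "nat \<Rightarrow> (nat \<times> nat) list" where
  "off_diagonal d = filter (\<lambda>(i, j). i \<noteq> j) (List.product [0..<Suc d] [0..<Suc d])"

definition p_config :: "nat \<Rightarrow> real \<Rightarrow> (nat \<Rightarrow> point) \<Rightarrow> point list" where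
  "p_config d s u = map u [0..<Suc d] @ map (\<lambda>(i, j). b_point s u i j) (off_diagonal d)"

definition q_config :: "nat \<Rightarrow> real \<Rightarrow> (nat \<Rightarrow> point) \<Rightarrow> point list" where
  "q_config d s u = map u [0..<Suc d] @ map (\<lambda>(i, j). c_point s u i j) (off_diagonal d)"

lemma set_off_diagonal: "set (off_diagonal d) = {(i, j). i \<le> d \<and> j \<le> d \<and> i \<noteq> j}"
  by (auto simp: off_diagonal_def)

lemma distinct_off_diagonal: "distinct (off_diagonal d)"
  unfolding off_diagonal_def by (intro distinct_filter distinct_product distinct_upt)

lemma length_off_diagonal: "length (off_diagonal d) = (d + 1) * d"
proof -
  have "set (off_diagonal d) = ({..d} \<times> {..d}) - (\<lambda>i. (i, i)) ` {..d}"
    by (auto simp: set_off_diagonal)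
  then have "card (set (off_diagonal d)) = card ({..d} \<times> {..d}) - card ((\<lambda>i. (i, i)) ` {..d})"
    by (simp only:) (rule card_Diff_subset, auto)
  also have "card ((\<lambda>i. (i, i)) ` {..d}) = d + 1"
    by (subst card_image) (auto simp: inj_on_def)
  finally show ?thesis
    by (simp add: distinct_card[OF distinct_off_diagonal] card_cartesian_product)
qed

lemma is_configuration_p_config:
  "\<forall>i\<le>d. u i \<in> E d \<Longrightarrow> is_configuration d ((d + 1)\<^sup>2) (p_config d s u)"
  by (auto simp: is_configuration_def p_config_def length_off_diagonal set_off_diagonal
      b_point_def topspace_Euclidean_space power2_eq_square)

lemma is_configuration_q_config:
  "\<forall>i\<le>d. u i \<in> E d \<Longrightarrow> is_configuration d ((d + 1)\<^sup>2) (q_config d s u)"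
  by (auto simp: is_configuration_def q_config_def length_off_diagonal set_off_diagonal
      c_point_def topspace_Euclidean_space power2_eq_square)

end

theory Submission
  imports Defs
begin

text \<open>
  Picture the point \<open>u j \<plusminus> s u i\<close> as the tip of a spike of length \<open>s\<close> planted at the vertex \<open>u j\<close>,
  pointing in the direction \<open>\<plusminus> u i\<close>. The second configuration arises from the first by flipping all
  spikes. The flip shortens no distance because \<open>u j \<bullet> u i\<close> takes its minimum for \<open>j \<noteq> i\<close>
  (\<open>edist_labelled_point_flip\<close>), and it preserves very many distances. A continuous expansion has to
  keep the latter constant throughout, and this already rules out dimensions below \<open>2 d\<close>.

  Write \<open>U j\<close> for the moving vertices. The constant distances have three consequences at each time:
  the spikes in direction \<open>i\<close> are one and the same vector \<open>W i\<close> at all their vertices;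
  \<open>W i\<close> is orthogonal to the facet of the moving simplex opposite to \<open>U i\<close>; and the \<open>W i\<close> have
  the Gram matrix of a regular simplex centred at the origin. The last two force
  \<open>W i \<bullet> (U i - U k)\<close>, for \<open>k \<noteq> i\<close>, to be one number \<open>x\<close> that depends on neither \<open>i\<close> nor \<open>k\<close>.
  The flip changes the sign of \<open>x\<close>, so at some moment \<open>x = 0\<close>. At that moment the \<open>W i\<close> are
  orthogonal to the whole simplex of the \<open>U j\<close>, and both simplices span \<open>d\<close> dimensions
  (\<open>orthogonal_moment_dimension\<close>), so the ambient space has dimension at least \<open>2 d\<close>.
\<close>

section \<open>The inner product and distances\<close>

definition ip :: "nat \<Rightarrow> point \<Rightarrow> point \<Rightarrow> real" where
  "ip n x y = (\<Sum>k<n. x k * y k)"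

lemma ip_commute: "ip n x y = ip n y x"
  by (simp add: ip_def mult.commute)

lemma ip_cong: "(\<And>k. k < n \<Longrightarrow> x k = x' k) \<Longrightarrow> (\<And>k. k < n \<Longrightarrow> y k = y' k) \<Longrightarrow> ip n x y = ip n x' y'"
  by (simp add: ip_def)

lemma ip_linear:
  "ip n (\<lambda>k. x k + y k) z = ip n x z + ip n y z"
  "ip n z (\<lambda>k. x k + y k) = ip n z x + ip n z y"
  "ip n (\<lambda>k. x k - y k) z = ip n x z - ip n y z"
  "ip n z (\<lambda>k. x k - y k) = ip n z x - ip n z y"
  "ip n (\<lambda>k. c * x k) z = c * ip n x z"
  "ip n z (\<lambda>k. c * x k) = c * ip n z x"
  by (simp_all add: ip_def algebra_simps sum.distrib sum_subtractf sum_distrib_left)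

lemma ip_sum_left: "ip n (\<lambda>k. \<Sum>i\<in>A. g i k) z = (\<Sum>i\<in>A. ip n (g i) z)"
  unfolding ip_def sum_distrib_right by (rule sum.swap)

lemma ip_zero_left: "(\<And>k. k < n \<Longrightarrow> x k = 0) \<Longrightarrow> ip n x y = 0"
  by (simp add: ip_def)

lemma ip_self_eq_0D: "ip n x x = 0 \<Longrightarrow> k < n \<Longrightarrow> x k = 0"
  by (simp add: ip_def sum_nonneg_eq_0_iff)

lemma enorm_power2: "(enorm n x)\<^sup>2 = ip n x x"
  by (simp add: enorm_def L2_set_def ip_def sum_nonneg power2_eq_square[symmetric])

lemma edist_power2: "(edist n x y)\<^sup>2 = ip n x x + ip n y y - 2 * ip n x y"
  by (simp add: edist_def enorm_power2 ip_linear ip_commute[of n y x])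

lemma edist_nonneg: "edist n x y \<ge> 0"
  by (simp add: edist_def enorm_def)

lemma edist_commute: "edist n x y = edist n y x"
  by (rule power2_eq_imp_eq) (simp_all add: edist_power2 edist_nonneg ip_commute[of n y x])

text \<open>Polarization for differences of four points: the inner product depends only on
  four distances. Everything known about a motion enters the argument through this identity.\<close>

lemma ip_differences_eq_edist:
  "2 * ip n (\<lambda>k. x k - y k) (\<lambda>k. z k - w k) =
     (edist n x w)\<^sup>2 + (edist n y z)\<^sup>2 - (edist n x z)\<^sup>2 - (edist n y w)\<^sup>2"
  by (simp add: edist_power2 ip_linear)

lemma ip_incl:
  assumes "d \<le> f"
  shows "ip f (incl d x) (incl d y) = ip d x y"
proof -
  have "ip f (incl d x) (incl d y) = (\<Sum>k\<in>{..<d}. incl d x k * incl d y k)"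
    unfolding ip_def by (rule sum.mono_neutral_right) (use assms in \<open>auto simp: incl_def\<close>)
  then show ?thesis
    by (simp add: ip_def incl_def)
qed

lemma edist_incl: "d \<le> f \<Longrightarrow> edist f (incl d x) (incl d y) = edist d x y"
  by (rule power2_eq_imp_eq) (simp_all add: edist_power2 ip_incl edist_nonneg)

section \<open>Linear independence in coordinates\<close>

text \<open>Gaussian elimination: the last coordinate is cleared with a pivot vector, which uses up one
  vector and one coordinate.\<close>

lemma nontrivial_relation:
  fixes v :: "'i \<Rightarrow> point"
  assumes "finite I" "f < card I"
  shows "\<exists>c. (\<exists>i\<in>I. c i \<noteq> 0) \<and> (\<forall>k<f. (\<Sum>i\<in>I. c i * v i k) = 0)"
  using assms
proof (induction f arbitrary: I v)
  case 0
  then show ?case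
    by (intro exI[of _ "\<lambda>_. 1"]) (auto simp: card_gt_0_iff)
next
  case (Suc f)
  show ?case
  proof (cases "\<forall>i\<in>I. v i f = 0")
    case True
    obtain c where c: "\<exists>i\<in>I. c i \<noteq> 0" "\<forall>k<f. (\<Sum>i\<in>I. c i * v i k) = 0"
      using Suc.IH[of I v] Suc.prems by auto
    with True show ?thesis
      by (intro exI[of _ c]) (auto simp: less_Suc_eq)
  next
    case False
    then obtain m where m: "m \<in> I" "v m f \<noteq> 0"
      by auto
    define J where "J = I - {m}"
    have J: "finite J" "f < card J" "m \<notin> J" "I = insert m J"
      using Suc.prems m by (auto simp: J_def)
    define r where "r i = v i f / v m f" for i
    obtain c where c: "\<exists>i\<in>J. c i \<noteq> 0"
      "\<forall>k<f. (\<Sum>i\<in>J. c i * (v i k - r i * v m k)) = 0"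
      using Suc.IH[of J "\<lambda>i k. v i k - r i * v m k"] J by auto
    have c_last: "(\<Sum>i\<in>J. c i * (v i f - r i * v m f)) = 0"
      using m by (simp add: r_def)
    define c' where "c' = c(m := - (\<Sum>i\<in>J. c i * r i))"
    have c'_sum: "(\<Sum>i\<in>I. c' i * v i k) = (\<Sum>i\<in>J. c i * (v i k - r i * v m k))" for k
    proof -
      have "(\<Sum>i\<in>J. c' i * v i k) = (\<Sum>i\<in>J. c i * v i k)"
        using J by (intro sum.cong) (auto simp: c'_def)
      moreover have "c' m = - (\<Sum>i\<in>J. c i * r i)"
        by (simp add: c'_def)
      ultimately show ?thesis
        using J by (simp add: algebra_simps sum_subtractf sum_distrib_left)
    qed
    have "\<exists>i\<in>I. c' i \<noteq> 0"
      using c(1) J by (auto simp: c'_def)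
    moreover have "\<forall>k<Suc f. (\<Sum>i\<in>I. c' i * v i k) = 0"
      unfolding c'_sum using c(2) c_last by (auto simp: less_Suc_eq)
    ultimately show ?thesis
      by blast
  qed
qed

text \<open>The Gram matrix of a simplex has the form \<open>\<alpha> I + \<beta> J\<close> with \<open>J\<close> the all-ones matrix, whose
  eigenvalues are \<open>\<alpha>\<close> and \<open>\<alpha> + d \<beta>\<close>; it is invertible when neither vanishes.\<close>

lemma simplex_gram_nonsingular:
  fixes c :: "nat \<Rightarrow> real"
  assumes eqs: "\<And>j. j \<in> {1..d} \<Longrightarrow> (\<Sum>i\<in>{1..d}. c i * (if i = j then \<alpha> + \<beta> else \<beta>)) = 0"
    and "\<alpha> \<noteq> 0" "\<alpha> + real d * \<beta> \<noteq> 0" "j \<in> {1..d}"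
  shows "c j = 0"
proof -
  define S where "S = (\<Sum>i\<in>{1..d}. c i)"
  have row: "\<alpha> * c j + \<beta> * S = 0" if j: "j \<in> {1..d}" for j
  proof -
    have "(\<Sum>i\<in>{1..d}. c i * (if i = j then \<alpha> + \<beta> else \<beta>)) =
        (\<Sum>i\<in>{1..d}. (if i = j then \<alpha> * c i else 0) + \<beta> * c i)"
      by (intro sum.cong) (auto simp: algebra_simps)
    also have "\<dots> = \<alpha> * c j + \<beta> * S"
      using j by (simp add: sum.distrib S_def sum_distrib_left)
    finally show ?thesis
      using eqs[OF j] by simp
  qed
  have "(\<Sum>j\<in>{1..d}. \<alpha> * c j + \<beta> * S) = 0"
    by (intro sum.neutral ballI row)
  then have "(\<alpha> + real d * \<beta>) * S = 0"
    by (simp add: sum.distrib S_def sum_distrib_left[symmetric] algebra_simps)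
  then show ?thesis
    using assms row[of j] by simp
qed

text \<open>In a linear relation between the vectors of two mutually orthogonal families the two parts
  vanish separately, and nonsingular Gram matrices kill the coefficients of each part.\<close>

lemma orthogonal_simplices_dimension:
  fixes V W :: "nat \<Rightarrow> point"
  assumes VV: "\<And>i j. i \<in> {1..d} \<Longrightarrow> j \<in> {1..d} \<Longrightarrow>
      ip f (V i) (V j) = (if i = j then \<alpha> + \<beta> else \<beta>)"
    and V_nonsing: "\<alpha> \<noteq> 0" "\<alpha> + real d * \<beta> \<noteq> 0"
    and WW: "\<And>i j. i \<in> {1..d} \<Longrightarrow> j \<in> {1..d} \<Longrightarrow>
      ip f (W i) (W j) = (if i = j then \<gamma> + \<delta> else \<delta>)"
    and W_nonsing: "\<gamma> \<noteq> 0" "\<gamma> + real d * \<delta> \<noteq> 0"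
    and VW: "\<And>i j. i \<in> {1..d} \<Longrightarrow> j \<in> {1..d} \<Longrightarrow> ip f (V i) (W j) = 0"
  shows "2 * d \<le> f"
proof (rule ccontr)
  assume "\<not> 2 * d \<le> f"
  then have "f < card ({1..d} <+> {1..d})"
    by (simp add: card_Plus)
  from nontrivial_relation[OF _ this, of "case_sum V W"]
  obtain c where nz: "\<exists>i\<in>{1..d} <+> {1..d}. c i \<noteq> 0"
    and c: "\<And>k. k < f \<Longrightarrow> (\<Sum>i\<in>{1..d} <+> {1..d}. c i * case_sum V W i k) = 0"
    by auto
  have rel: "(\<Sum>i\<in>{1..d}. c (Inl i) * V i k) + (\<Sum>i\<in>{1..d}. c (Inr i) * W i k) = 0"
    if "k < f" for k
    using c[OF that] by (simp add: sum.Plus)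
  have ip_rel: "(\<Sum>i\<in>{1..d}. c (Inl i) * ip f (V i) z) + (\<Sum>i\<in>{1..d}. c (Inr i) * ip f (W i) z) = 0"
    for z
  proof -
    have "ip f (\<lambda>k. (\<Sum>i\<in>{1..d}. c (Inl i) * V i k) + (\<Sum>i\<in>{1..d}. c (Inr i) * W i k)) z = 0"
      by (rule ip_zero_left) (rule rel)
    then show ?thesis
      by (simp add: ip_linear ip_sum_left)
  qed
  have "c (Inl j) = 0" if "j \<in> {1..d}" for j
  proof (rule simplex_gram_nonsingular[OF _ V_nonsing that])
    fix j assume "j \<in> {1..d}"
    then show "(\<Sum>i\<in>{1..d}. c (Inl i) * (if i = j then \<alpha> + \<beta> else \<beta>)) = 0"
      using ip_rel[of "V j"] VW by (simp add: VV ip_commute[of f "W _" "V _"])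
  qed
  moreover have "c (Inr j) = 0" if "j \<in> {1..d}" for j
  proof (rule simplex_gram_nonsingular[OF _ W_nonsing that])
    fix j assume "j \<in> {1..d}"
    then show "(\<Sum>i\<in>{1..d}. c (Inr i) * (if i = j then \<gamma> + \<delta> else \<delta>)) = 0"
      using ip_rel[of "W j"] VW by (simp add: WW)
  qed
  ultimately show False
    using nz by auto
qed

text \<open>The directions \<open>W i\<close> form a simplex centred at the origin, so they sum to zero. Pairing
  this relation with an edge \<open>U i - U k\<close>, to which all \<open>W m\<close> other than \<open>W i\<close> and \<open>W k\<close> are
  orthogonal, shows that \<open>W i\<close> has the same component along the altitude of the simplex \<open>U\<close> from
  \<open>U i\<close> for every \<open>i\<close>. If one of these components vanishes, all do, and the two simplices span
  orthogonal spaces of dimension \<open>d\<close>.\<close>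

lemma orthogonal_moment_dimension:
  fixes U W :: "nat \<Rightarrow> point"
  assumes "d \<ge> 1" "s > 0"
    and UU: "\<And>i j. i \<in> {1..d} \<Longrightarrow> j \<in> {1..d} \<Longrightarrow>
      ip f (\<lambda>n. U i n - U 0 n) (\<lambda>n. U j n - U 0 n) = (1 + 1 / real d) * (if i = j then 2 else 1)"
    and WW: "\<And>i j. i \<le> d \<Longrightarrow> j \<le> d \<Longrightarrow> ip f (W i) (W j) = s\<^sup>2 * (if i = j then 1 else - 1 / real d)"
    and WU: "\<And>i k l. i \<le> d \<Longrightarrow> k \<le> d \<Longrightarrow> l \<le> d \<Longrightarrow> k \<noteq> i \<Longrightarrow> l \<noteq> i \<Longrightarrow>
      ip f (W i) (\<lambda>n. U k n - U l n) = 0"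
    and W0: "ip f (W 0) (\<lambda>n. U 0 n - U 1 n) = 0"
  shows "2 * d \<le> f"
proof -
  have row: "(\<Sum>i\<le>d. ip f (W i) (W j)) = 0" if "j \<le> d" for j
  proof -
    have "(\<Sum>i\<le>d. ip f (W i) (W j)) =
        (\<Sum>i\<le>d. (if i = j then s\<^sup>2 * (1 + 1 / real d) else 0) - s\<^sup>2 / real d)"
      using that by (intro sum.cong) (auto simp: WW algebra_simps)
    also have "\<dots> = 0"
      using that \<open>d \<ge> 1\<close> unfolding sum_subtractf by (simp add: field_simps)
    finally show ?thesis .
  qed
  define Z where "Z = (\<lambda>k. \<Sum>i\<le>d. W i k)"
  have "ip f Z Z = (\<Sum>j\<le>d. ip f (W j) Z)"
    by (subst Z_def) (simp add: ip_sum_left)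
  also have "\<dots> = 0"
    using row by (intro sum.neutral ballI, subst ip_commute) (simp add: Z_def ip_sum_left)
  finally have Z0: "Z k = 0" if "k < f" for k
    using ip_self_eq_0D that by blast
  have sum0: "(\<Sum>i\<le>d. ip f (W i) z) = 0" for z
    unfolding ip_sum_left[symmetric] Z_def[symmetric] by (rule ip_zero_left) (rule Z0)
  have W0_all: "ip f (W 0) (\<lambda>n. U j n - U 0 n) = 0" if "j \<in> {1..d}" for j
    using WU[of 0 j 1] W0 that \<open>d \<ge> 1\<close> by (simp add: ip_linear)
  have alt: "ip f (W i) (\<lambda>n. U i n - U 0 n) = 0" if "i \<in> {1..d}" for i
  proof -
    have "(\<Sum>m\<le>d. ip f (W m) (\<lambda>n. U i n - U 0 n)) =
        (\<Sum>m\<in>{0, i}. ip f (W m) (\<lambda>n. U i n - U 0 n))"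
      using that by (intro sum.mono_neutral_right) (auto intro!: WU)
    then show ?thesis
      using W0_all[OF that] sum0[of "\<lambda>n. U i n - U 0 n"] that by simp
  qed
  have UW: "ip f (\<lambda>n. U j n - U 0 n) (W i) = 0" if "i \<in> {1..d}" "j \<in> {1..d}" for i j
    using alt[OF that(1)] WU[of i j 0] that unfolding ip_commute[of f _ "W i"] by (cases "i = j") auto
  show ?thesis
  proof (rule orthogonal_simplices_dimension[of d f "\<lambda>i n. U i n - U 0 n"
        "1 + 1 / real d" "1 + 1 / real d" W "s\<^sup>2 * (1 + 1 / real d)" "- (s\<^sup>2 / real d)"])
    fix i j assume ij: "i \<in> {1..d}" "j \<in> {1..d}"
    show "ip f (\<lambda>n. U i n - U 0 n) (\<lambda>n. U j n - U 0 n) =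
        (if i = j then 1 + 1 / real d + (1 + 1 / real d) else 1 + 1 / real d)"
      using UU[OF ij] by simp
    show "ip f (W i) (W j) =
        (if i = j then s\<^sup>2 * (1 + 1 / real d) + - (s\<^sup>2 / real d) else - (s\<^sup>2 / real d))"
      using WW[of i j] ij by (simp add: algebra_simps)
    show "ip f (\<lambda>n. U i n - U 0 n) (W j) = 0"
      by (rule UW[OF ij(2,1)])
  next
    have "1 + 1 / real d > 0"
      using \<open>d \<ge> 1\<close> by (simp add: add_pos_pos)
    then show "1 + 1 / real d \<noteq> 0" "s\<^sup>2 * (1 + 1 / real d) \<noteq> 0"
      "1 + 1 / real d + real d * (1 + 1 / real d) \<noteq> 0"
      using \<open>s > 0\<close> by (simp_all add: add_pos_nonneg less_imp_neq[symmetric])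
    show "s\<^sup>2 * (1 + 1 / real d) + real d * - (s\<^sup>2 / real d) \<noteq> 0"
      using \<open>s > 0\<close> \<open>d \<ge> 1\<close> by (simp add: field_simps)
  qed
qed

section \<open>The configurations\<close>

lemma centred_regular_simplex_gram:
  assumes "d \<ge> 1" and reg: "regular_simplex_vertices d u"
    and cen: "centroid d u = (\<lambda>k. 0)" and unit: "\<forall>i\<le>d. enorm d (u i) = 1"
    and "i \<le> d" "j \<le> d"
  shows "ip d (u i) (u j) = (if i = j then 1 else - 1 / real d)"
proof -
  obtain a where a: "\<And>i j. i \<le> d \<Longrightarrow> j \<le> d \<Longrightarrow> i \<noteq> j \<Longrightarrow> edist d (u i) (u j) = a"
    using reg unfolding regular_simplex_vertices_def by blast
  have self: "ip d (u i) (u i) = 1" if "i \<le> d" for i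
    using unit that enorm_power2[of d "u i"] by simp
  define c where "c = 1 - a\<^sup>2 / 2"
  have off: "ip d (u k) (u j) = (if k = j then 1 - c else 0) + c" if "k \<le> d" for k
    using a[OF that \<open>j \<le> d\<close>] edist_power2[of d "u k" "u j"] self that \<open>j \<le> d\<close>
    by (auto simp: c_def diff_divide_distrib)
  have zero: "(\<Sum>k\<le>d. u k n) = 0" for n
    using fun_cong[OF cen, of n] by (simp add: centroid_def)
  have "0 = (\<Sum>k\<le>d. ip d (u k) (u j))"
    by (simp add: ip_sum_left[symmetric] zero ip_zero_left)
  also have "\<dots> = (\<Sum>k\<le>d. (if k = j then 1 - c else 0) + c)"
    by (intro sum.cong) (auto simp: off)
  also have "\<dots> = 1 + real d * c"
    using \<open>j \<le> d\<close> by (simp add: sum.distrib algebra_simps)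
  finally have "c = - 1 / real d"
    using \<open>d \<ge> 1\<close> by (simp add: field_simps)
  then show ?thesis
    using off[OF \<open>i \<le> d\<close>] by simp
qed

text \<open>Both configurations are read as images of one list of labels \<open>(i, j)\<close>, standing for the tip of
  the spike in direction \<open>i\<close> at the vertex \<open>u j\<close>. The diagonal label \<open>(j, j)\<close> gets a spike of length
  zero and so stands for \<open>u j\<close> itself. This way all pairs of points obey the same formulas, and the
  second configuration is the first one with \<open>s\<close> replaced by \<open>-s\<close>.\<close>

definition spike :: "real \<Rightarrow> nat \<times> nat \<Rightarrow> real" where
  "spike s a = (if fst a = snd a then 0 else s)"

definition labelled_point :: "(nat \<Rightarrow> point) \<Rightarrow> real \<Rightarrow> nat \<times> nat \<Rightarrow> point" where
  "labelled_point u s a = (\<lambda>k. u (snd a) k + spike s a * u (fst a) k)"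

lemma spike_uminus: "spike (- s) a = - spike s a"
  by (simp add: spike_def)

lemma ip_labelled_point:
  "ip n (labelled_point u s a) (labelled_point u r b) =
     ip n (u (snd a)) (u (snd b)) + spike r b * ip n (u (snd a)) (u (fst b)) +
     spike s a * ip n (u (fst a)) (u (snd b)) +
     spike s a * spike r b * ip n (u (fst a)) (u (fst b))"
  by (simp add: labelled_point_def ip_linear algebra_simps)

definition labels :: "nat \<Rightarrow> (nat \<times> nat) list" where
  "labels d = map (\<lambda>i. (i, i)) [0..<Suc d] @ off_diagonal d"

lemma set_labels: "set (labels d) = {..d} \<times> {..d}"
  by (auto simp: labels_def set_off_diagonal simp del: upt_Suc)

lemma p_config_labels: "p_config d s u = map (labelled_point u s) (labels d)"
  by (auto simp: p_config_def labels_def labelled_point_def spike_def b_point_def set_off_diagonal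
      simp del: upt_Suc)

lemma q_config_labels: "q_config d s u = map (labelled_point u (- s)) (labels d)"
  by (auto simp: q_config_def labels_def labelled_point_def spike_def c_point_def set_off_diagonal
      simp del: upt_Suc)

text \<open>The pairs of points whose distance is the same before and after the flip: neither point has its
  spike in the direction of the other one's base vertex.\<close>

definition rigid_pair :: "nat \<times> nat \<Rightarrow> nat \<times> nat \<Rightarrow> bool" where
  "rigid_pair a b \<longleftrightarrow>
     (fst a = snd a \<or> snd b \<noteq> fst a) \<and> (fst b = snd b \<or> snd a \<noteq> fst b)"

text \<open>For a proper spike \<open>(i, j)\<close> with \<open>j \<noteq> i\<close> the number \<open>u j \<bullet> u i\<close> is the least possible one,
  \<open>-1/d\<close>. So the spike at \<open>u j\<close> has a nonpositive inner product with \<open>u j - u l\<close> for every base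
  vertex \<open>u l\<close>, which vanishes unless \<open>l = i\<close>. The squared distance of two points changes under the
  flip by \<open>-4\<close> times the sum of two such inner products.\<close>

lemma edist_labelled_point_flip:
  assumes "d \<ge> 1" "s > 0"
    and gram: "\<And>i j. i \<le> d \<Longrightarrow> j \<le> d \<Longrightarrow> ip d (u i) (u j) = (if i = j then 1 else - 1 / real d)"
    and a: "a \<in> {..d} \<times> {..d}" and b: "b \<in> {..d} \<times> {..d}"
  shows "edist d (labelled_point u s a) (labelled_point u s b) \<le>
      edist d (labelled_point u (- s) a) (labelled_point u (- s) b)"
    and "rigid_pair a b \<Longrightarrow> edist d (labelled_point u s a) (labelled_point u s b) =
      edist d (labelled_point u (- s) a) (labelled_point u (- s) b)"
proof -
  obtain i j k l where ab: "a = (i, j)" "b = (k, l)"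
    by (metis surj_pair)
  have le: "i \<le> d" "j \<le> d" "k \<le> d" "l \<le> d"
    using a b ab by auto
  define g where "g a l = spike s a * (ip d (u l) (u (fst a)) - ip d (u (snd a)) (u (fst a)))"
    for a l
  have sq: "(edist d (labelled_point u (- s) a) (labelled_point u (- s) b))\<^sup>2 =
      (edist d (labelled_point u s a) (labelled_point u s b))\<^sup>2 + 4 * (g a l + g b j)"
    unfolding edist_power2 ip_labelled_point spike_uminus
    by (simp add: ab g_def ip_commute algebra_simps)
  have g: "g (i, j) l = (if i \<noteq> j \<and> l = i then s * (1 + 1 / real d) else 0)"
    if "i \<le> d" "j \<le> d" "l \<le> d" for i j l
    using that by (simp add: g_def spike_def gram)
  have "g a l + g b j \<ge> 0"
    using \<open>s > 0\<close> le by (simp add: ab g)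
  with sq show "edist d (labelled_point u s a) (labelled_point u s b) \<le>
      edist d (labelled_point u (- s) a) (labelled_point u (- s) b)"
    using power2_le_imp_le[OF _ edist_nonneg] by fastforce
  assume "rigid_pair a b"
  then have "g a l + g b j = 0"
    using le by (auto simp: ab g rigid_pair_def)
  with sq show "edist d (labelled_point u s a) (labelled_point u s b) =
      edist d (labelled_point u (- s) a) (labelled_point u (- s) b)"
    using power2_eq_imp_eq[OF _ edist_nonneg edist_nonneg] by fastforce
qed

section \<open>Motions\<close>

lemma continuous_expansion_mapE:
  assumes "continuous_expansion d f (map P L) (map Q L)" and [simp]: "set L = A"
  obtains G :: "'a \<Rightarrow> real \<Rightarrow> point" where
    "\<forall>a\<in>A. \<forall>n. continuous_on {0..1} (\<lambda>t. G a t n)"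
    "\<forall>a\<in>A. G a 0 = incl d (P a)"
    "\<forall>a\<in>A. G a 1 = incl d (Q a)"
    "\<forall>a\<in>A. \<forall>b\<in>A. \<forall>t1 t2. 0 \<le> t1 \<and> t1 \<le> t2 \<and> t2 \<le> 1 \<longrightarrow>
       edist f (G a t1) (G b t1) \<le> edist f (G a t2) (G b t2)"
proof -
  obtain F :: "nat \<Rightarrow> real \<Rightarrow> point" where F_all: "\<forall>k < length L.
      continuous_map (top_of_set {0..1}) (Euclidean_space f) (F k) \<and>
      F k 0 = incl d (P (L ! k)) \<and> F k 1 = incl d (Q (L ! k))"
    and mono: "\<forall>i j t1 t2. i < j \<and> j < length L \<and> 0 \<le> t1 \<and> t1 < t2 \<and> t2 \<le> 1 \<longrightarrow>
      edist f (F i t1) (F j t1) \<le> edist f (F i t2) (F j t2)"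
    using assms(1) unfolding continuous_expansion_def by auto
  note F = F_all[rule_format]
  define idx where "idx a = (SOME k. k < length L \<and> L ! k = a)" for a
  have idx: "idx a < length L" "L ! idx a = a" if "a \<in> A" for a
    using someI_ex[of "\<lambda>k. k < length L \<and> L ! k = a"] that
    by (auto simp: idx_def \<open>set L = A\<close>[symmetric] in_set_conv_nth simp del: \<open>set L = A\<close>)
  have cont: "continuous_on {0..1} (\<lambda>t. F k t n)" if "k < length L" for k n
  proof -
    have "continuous_map (top_of_set {0..1}) (powertop_real UNIV) (F k)"
      using F[OF that] unfolding Euclidean_space_def continuous_map_in_subtopology by blast
    then show ?thesis
      by (simp add: continuous_map_componentwise_UNIV)
  qed
  have self: "edist f x x = 0" for x
    by (simp add: edist_def enorm_def L2_set_def)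
  have "edist f (F (idx a) t1) (F (idx b) t1) \<le> edist f (F (idx a) t2) (F (idx b) t2)"
    if *: "a \<in> A" "b \<in> A" "0 \<le> t1" "t1 \<le> t2" "t2 \<le> 1" for a b t1 t2
  proof -
    consider "t1 = t2" | "idx a = idx b" | "t1 < t2" "idx a < idx b" | "t1 < t2" "idx b < idx a"
      using * by linarith
    then show ?thesis
    proof cases
      case 4
      then show ?thesis
        using mono[rule_format, of "idx b" "idx a" t1 t2] idx * by (simp add: edist_commute)
    qed (use mono[rule_format, of "idx a" "idx b" t1 t2] idx * in \<open>simp_all add: self\<close>)
  qed
  then show thesis
    using F idx cont by (intro that[of "\<lambda>a. F (idx a)"]) auto
qed

text \<open>During a continuous expansion the distance of a rigid pair is monotone with equal end
  values, hence constant; by polarization, so is the inner product of two difference vectors whose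
  four cross pairs are rigid. Such inner products are evaluated in the initial configuration, which
  gives all the relations that \<open>orthogonal_moment_dimension\<close> asks for except the vanishing of one
  altitude component. The latter is arranged by choosing the time, since that component starts
  positive and ends with the opposite value.\<close>

lemma spike_flip_dimension:
  assumes "d \<ge> 2" "s > 0" "d \<le> f"
    and gram: "\<And>i j. i \<le> d \<Longrightarrow> j \<le> d \<Longrightarrow> ip d (u i) (u j) = (if i = j then 1 else - 1 / real d)"
    and ce: "continuous_expansion d f (p_config d s u) (q_config d s u)"
  shows "2 * d \<le> f"
proof -
  let ?P = "labelled_point u s" and ?Q = "labelled_point u (- s)"
  obtain G :: "nat \<times> nat \<Rightarrow> real \<Rightarrow> point"
    where G: "\<forall>a\<in>{..d} \<times> {..d}. \<forall>n. continuous_on {0..1} (\<lambda>t. G a t n)"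
      "\<forall>a\<in>{..d} \<times> {..d}. G a 0 = incl d (?P a)"
      "\<forall>a\<in>{..d} \<times> {..d}. G a 1 = incl d (?Q a)"
      "\<forall>a\<in>{..d} \<times> {..d}. \<forall>b\<in>{..d} \<times> {..d}. \<forall>t1 t2. 0 \<le> t1 \<and> t1 \<le> t2 \<and> t2 \<le> 1 \<longrightarrow>
         edist f (G a t1) (G b t1) \<le> edist f (G a t2) (G b t2)"
    by (rule continuous_expansion_mapE[OF ce[unfolded p_config_labels q_config_labels] set_labels])
  note cont = G(1)[rule_format] and G0 = G(2)[rule_format] and G1 = G(3)[rule_format]
  have mono: "edist f (G a t1) (G b t1) \<le> edist f (G a t2) (G b t2)"
    if "a \<in> {..d} \<times> {..d}" "b \<in> {..d} \<times> {..d}" "0 \<le> t1" "t1 \<le> t2" "t2 \<le> 1" for a b t1 t2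
    using G(4) that by blast
  have rigid: "edist f (G a t) (G b t) = edist d (?P a) (?P b)"
    if "a \<in> {..d} \<times> {..d}" "b \<in> {..d} \<times> {..d}" "rigid_pair a b" "t \<in> {0..1}" for a b t
    using mono[OF that(1,2), of 0 t] mono[OF that(1,2), of t 1] that
      edist_labelled_point_flip(2)[of d s u a b] gram \<open>d \<ge> 2\<close> \<open>s > 0\<close>
    by (simp add: G0 G1 edist_incl[OF \<open>d \<le> f\<close>])
  have rigid_ip: "ip f (\<lambda>n. G a t n - G b t n) (\<lambda>n. G c t n - G e t n) =
      ip d (\<lambda>n. ?P a n - ?P b n) (\<lambda>n. ?P c n - ?P e n)"
    if "t \<in> {0..1}" "{a, b, c, e} \<subseteq> {..d} \<times> {..d}"
      "rigid_pair a c" "rigid_pair a e" "rigid_pair b c" "rigid_pair b e" for t a b c e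
    using ip_differences_eq_edist[of f "G a t" "G b t" "G c t" "G e t"]
      ip_differences_eq_edist[of d "?P a" "?P b" "?P c" "?P e"] that
    by (simp add: rigid)
  \<comment> \<open>the altitude component of spike \<open>0\<close>; its factors have the cross pair \<open>(0, 1)\<close>, \<open>(0, 0)\<close>, which
    is not rigid, so it may vary in time\<close>
  define x where "x t = ip f (\<lambda>n. G (0, 1) t n - G (1, 1) t n) (\<lambda>n. G (0, 0) t n - G (1, 1) t n)" for t
  have x0: "x 0 = s * (1 + 1 / real d)" and x1: "x 1 = - (s * (1 + 1 / real d))"
    using \<open>d \<ge> 2\<close> by (simp_all add: x_def G0 G1 ip_linear ip_incl[OF \<open>d \<le> f\<close>] ip_labelled_point
        spike_def gram algebra_simps)
  have "continuous_on {0..1} x"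
    unfolding x_def ip_def using \<open>d \<ge> 2\<close> by (intro continuous_intros cont) auto
  then obtain t where t: "0 \<le> t" "t \<le> 1" "x t = 0"
    using IVT2'[of x 1 0 0] x0 x1 \<open>s > 0\<close> by auto
  have t01: "t \<in> {0..1}"
    using t by simp
  define U where "U j = G (j, j) t" for j
  define W where "W i = (let j = if i = 0 then 1 else 0 in (\<lambda>n. G (i, j) t n - U j n))" for i :: nat
  \<comment> \<open>two spikes in direction \<open>i\<close> have length \<open>s\<close> and inner product \<open>s\<^sup>2\<close>, so they coincide\<close>
  have spikes: "ip f (\<lambda>n. G (i, j) t n - U j n) (\<lambda>n. G (i, k) t n - U k n) = s\<^sup>2"
    if "i \<le> d" "j \<le> d" "k \<le> d" "j \<noteq> i" "k \<noteq> i" for i j k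
    unfolding U_def using that t01
    by (subst rigid_ip) (auto simp: rigid_pair_def ip_linear ip_labelled_point spike_def gram
        power2_eq_square)
  have W_eq: "W i n = G (i, j) t n - U j n" if "i \<le> d" "j \<le> d" "j \<noteq> i" "n < f" for i j n
  proof -
    define k where "k = (if i = 0 then 1 else 0 :: nat)"
    have k: "k \<le> d" "k \<noteq> i" "W i = (\<lambda>n. G (i, k) t n - U k n)"
      using \<open>d \<ge> 2\<close> by (auto simp: k_def W_def)
    let ?A = "\<lambda>n. G (i, k) t n - U k n" and ?B = "\<lambda>n. G (i, j) t n - U j n"
    have "ip f (\<lambda>n. ?A n - ?B n) (\<lambda>n. ?A n - ?B n) = ip f ?A ?A - ip f ?A ?B - (ip f ?B ?A - ip f ?B ?B)"
      by (simp only: ip_linear)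
    also have "\<dots> = 0"
      using that k(1,2) by (simp add: spikes)
    finally show ?thesis
      using ip_self_eq_0D[of f "\<lambda>n. ?A n - ?B n" n] \<open>n < f\<close> k(3) by simp
  qed
  show ?thesis
  proof (rule orthogonal_moment_dimension[of d s f U W])
    show "d \<ge> 1" "s > 0"
      using assms by auto
    show "ip f (\<lambda>n. U i n - U 0 n) (\<lambda>n. U j n - U 0 n) = (1 + 1 / real d) * (if i = j then 2 else 1)"
      if "i \<in> {1..d}" "j \<in> {1..d}" for i j
      unfolding U_def using that t01
      by (subst rigid_ip) (auto simp: rigid_pair_def ip_linear ip_labelled_point spike_def gram)
    show "ip f (W i) (W j) = s\<^sup>2 * (if i = j then 1 else - 1 / real d)"
      if "i \<le> d" "j \<le> d" for i j
    proof -
      \<comment> \<open>a base vertex for comparing both spikes; its existence is where \<open>d \<ge> 2\<close> matters\<close>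
      obtain k where k: "k \<le> d" "k \<noteq> i" "k \<noteq> j"
        using that[of 0] that[of 1] that[of 2] \<open>d \<ge> 2\<close> by fastforce
      have "ip f (W i) (W j) = ip f (\<lambda>n. G (i, k) t n - U k n) (\<lambda>n. G (j, k) t n - U k n)"
        using k that by (intro ip_cong W_eq) auto
      also have "\<dots> = s\<^sup>2 * (if i = j then 1 else - 1 / real d)"
        unfolding U_def using that k t01
        by (subst rigid_ip) (auto simp: rigid_pair_def ip_linear ip_labelled_point spike_def gram
            power2_eq_square)
      finally show ?thesis .
    qed
    show "ip f (W i) (\<lambda>n. U k n - U l n) = 0"
      if "i \<le> d" "k \<le> d" "l \<le> d" "k \<noteq> i" "l \<noteq> i" for i k l
    proof -
      have "ip f (W i) (\<lambda>n. U k n - U l n) = ip f (\<lambda>n. G (i, k) t n - U k n) (\<lambda>n. U k n - U l n)"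
        using that by (intro ip_cong W_eq) auto
      also have "\<dots> = 0"
        unfolding U_def using that t01
        by (subst rigid_ip) (auto simp: rigid_pair_def ip_linear ip_labelled_point spike_def gram)
      finally show ?thesis .
    qed
    show "ip f (W 0) (\<lambda>n. U 0 n - U 1 n) = 0"
      using t(3) by (simp add: x_def W_def U_def)
  qed
qed

section \<open>Expansion without continuous expansion\<close>

theorem theorem2p1:
  fixes d :: nat and s :: real and u :: "nat \<Rightarrow> point"
  assumes "d \<ge> 2" and "s > 0"
    and "regular_simplex_vertices d u"
    and "centroid d u = (\<lambda>k. 0)"
    and "\<forall>i\<le>d. enorm d (u i) = 1"
  shows "is_expansion d (p_config d s u) (q_config d s u) \<and>
         (\<forall>f. d \<le> f \<and> f < 2 * d \<longrightarrow>
            \<not> continuous_expansion d f (p_config d s u) (q_config d s u))"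
proof
  have d: "d \<ge> 1"
    using assms(1) by simp
  note gram = centred_regular_simplex_gram[OF d assms(3-5)]
  show "is_expansion d (p_config d s u) (q_config d s u)"
    unfolding is_expansion_def p_config_labels q_config_labels
  proof (intro conjI allI impI)
    fix i j assume "i < j \<and> j < length (map (labelled_point u s) (labels d))"
    moreover from this have "labels d ! i \<in> {..d} \<times> {..d}" "labels d ! j \<in> {..d} \<times> {..d}"
      by (simp_all add: set_labels[symmetric] del: mem_Sigma_iff)
    ultimately show "edist d (map (labelled_point u s) (labels d) ! i)
          (map (labelled_point u s) (labels d) ! j)
        \<le> edist d (map (labelled_point u (- s)) (labels d) ! i)
          (map (labelled_point u (- s)) (labels d) ! j)"
      using edist_labelled_point_flip(1)[OF d assms(2) gram] by simp
  qed simp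
  show "\<forall>f. d \<le> f \<and> f < 2 * d \<longrightarrow> \<not> continuous_expansion d f (p_config d s u) (q_config d s u)"
    using spike_flip_dimension[OF assms(1,2) _ gram] by (meson not_less)
qed

end
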